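(* Let $n\ge 2$, let $X=\{x_i\}_{i=1}^n$ with $a=x_1<x_2<\dots<x_n=b$, and let $\alpha>0$. Let $\mathcal{E}_{X,\alpha}\subset C^2([a,b])$ be the space of exponential-polynomial splines on $X$, let $I_{X,\alpha}$ be the associated interpolation operator at the points of $X$, and let $\lambda(x)=\sum_{j=1}^n|\psi_j(x)|$ be the associated Lebesgue function, where $\psi_1,\dots,\psi_n$ is the cardinal basis of $\mathcal{E}_{X,\alpha}$. Let $f\in C([a,b])$ and let $f^\star_{X,\alpha}\in\mathcal{E}_{X,\alpha}$ be its best approximation in $\mathcal{E}_{X,\alpha}$ with respect to the norm $\|\cdot\|_\infty$ on $[a,b]$. Then $$\left|\left(f-I_{X,\alpha}(f)\right)(x)\right|\le \left(1+\lambda(x)\right)\left\|f-f^\star_{X,\alpha}\right\|_\infty,\qquad x\in[a,b].$$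
   Context: Let $\mathbb{E}_{4,\alpha}=\operatorname{span}\{e^{\alpha x},\,x e^{\alpha x},\,e^{-\alpha x},\,x e^{-\alpha x}\}$; this is the null space of $\mathcal{L}_2^*\mathcal{L}_2$, where $\mathcal{L}_2u=u''+2\alpha u'+\alpha^2u$ and $\mathcal{L}_2^*$ is its adjoint. The node set $X$ is augmented by four fixed extra nodes, $x_{-1}<x_0<x_1=a<\dots<x_n=b<x_{n+1}<x_{n+2}$. For $1\le j\le n$, the GB-spline (generalized B-spline) $\varphi_j$ is a nonzero, bell-shaped function of class $C^2$ on $\mathbb{R}$ with $\operatorname{supp}(\varphi_j)\subset[x_{j-2},x_{j+2}]$, whose restriction to each interval $[x_i,x_{i+1}]$ between consecutive augmented nodes belongs to $\mathbb{E}_{4,\alpha}$ (it is determined up to a nonzero scalar factor, which is fixed). The space of exponential-polynomial splines $\mathcal{E}_{X,\alpha}$ is the $n$-dimensional space spanned by the restrictions of $\varphi_1,\dots,\varphi_n$ to $[a,b]$. Standing assumption: the collocation matrix $\mathsf{\Phi}=(\varphi_j(x_i))_{i,j=1}^n$ is invertible. For $f:[a,b]\to\mathbb{R}$, the interpolant is $I_{X,\alpha}(f)=\sum_{j=1}^n c_j\varphi_j$, where $\boldsymbol{c}=[c_1,\dots,c_n]^{\intercal}$ solves $\mathsf{\Phi}\boldsymbol{c}=[f(x_1),\dots,f(x_n)]^{\intercal}$; that is, it is the unique element of $\mathcal{E}_{X,\alpha}$ agreeing with $f$ on $X$. The cardinal (Lagrange) basis is $\psi_\ell=\sum_{j=1}^n(\mathsf{\Phi}^{-1})_{j\ell}\,\varphi_j$,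 $1\le\ell\le n$, which satisfies $\psi_\ell(x_i)=\delta_{i\ell}$ for $1\le i,\ell\le n$. A best approximation $f^\star_{X,\alpha}$ of $f$ in $\mathcal{E}_{X,\alpha}$ is an element of $\mathcal{E}_{X,\alpha}$ minimizing $\|f-g\|_\infty=\sup_{x\in[a,b]}|f(x)-g(x)|$ over $g\in\mathcal{E}_{X,\alpha}$. *)

theory Defs
  imports
    "HOL-Analysis.Analysis"
    "Jordan_Normal_Form.Gauss_Jordan_Elimination"
begin

no_notation vec_nth (infixl "$" 90)

definition exp_poly_space :: "real \<Rightarrow> (real \<Rightarrow> real) set" where
  "exp_poly_space \<alpha> =
    {\<lambda>t. c1 * exp (\<alpha> * t) + c2 * (t * exp (\<alpha> * t)) +
         c3 * exp (- \<alpha> * t) + c4 * (t * exp (- \<alpha> * t)) | c1 c2 c3 c4. True}"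

definition C2_real :: "(real \<Rightarrow> real) \<Rightarrow> bool" where
  "C2_real g \<longleftrightarrow>
    (\<exists>g' g''. (\<forall>t. (g has_real_derivative g' t) (at t)) \<and>
              (\<forall>t. (g' has_real_derivative g'' t) (at t)) \<and>
              continuous_on UNIV g'')"

definition bell_shaped :: "(real \<Rightarrow> real) \<Rightarrow> bool" where
  "bell_shaped g \<longleftrightarrow> (\<exists>m. mono_on {..m} g \<and> antimono_on {m..} g)"

text \<open>The nodes are indexed by integers: the interpolation nodes are \<open>x 1, \<dots>, x n\<close> and the four
  extra ones are \<open>x (-1), x 0, x (n + 1), x (n + 2)\<close>; other values of \<open>x\<close> are irrelevant.\<close>

definition augmented_nodes :: "nat \<Rightarrow> (int \<Rightarrow> real) \<Rightarrow> bool" where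
  "augmented_nodes n x \<longleftrightarrow> strict_mono_on {-1..int n + 2} x"

text \<open>Being bell-shaped is required up to a nonzero factor, because the normalisation of a GB-spline,
  including its sign, is arbitrary.\<close>

definition gb_spline :: "real \<Rightarrow> nat \<Rightarrow> (int \<Rightarrow> real) \<Rightarrow> nat \<Rightarrow> (real \<Rightarrow> real) \<Rightarrow> bool" where
  "gb_spline \<alpha> n x j g \<longleftrightarrow>
    (\<exists>t. g t \<noteq> 0) \<and>
    (\<exists>r. r \<noteq> 0 \<and> bell_shaped (\<lambda>t. r * g t)) \<and>
    C2_real g \<and>
    closure {t. g t \<noteq> 0} \<subseteq> {x (int j - 2)..x (int j + 2)} \<and>
    (\<forall>i\<in>{-1..int n + 1}. \<exists>p\<in>exp_poly_space \<alpha>. \<forall>t\<in>{x i..x (i + 1)}. g t = p t)"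

text \<open>Below, \<open>\<phi> j\<close> is meant for \<open>1 \<le> j \<le> n\<close>, whereas vectors and matrices are indexed from \<open>0\<close>.
  Elements of the spline space are functions on \<open>[x 1, x n]\<close>, extended by \<^term>\<open>undefined\<close>.\<close>

definition spline :: "nat \<Rightarrow> (int \<Rightarrow> real) \<Rightarrow> (nat \<Rightarrow> real \<Rightarrow> real) \<Rightarrow> real vec \<Rightarrow> real \<Rightarrow> real" where
  "spline n x \<phi> c = (\<lambda>t\<in>{x 1..x (int n)}. \<Sum>j = 1..n. c $ (j - 1) * \<phi> j t)"

definition spline_space :: "nat \<Rightarrow> (int \<Rightarrow> real) \<Rightarrow> (nat \<Rightarrow> real \<Rightarrow> real) \<Rightarrow> (real \<Rightarrow> real) set" where
  "spline_space n x \<phi> = spline n x \<phi> ` carrier_vec n"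

definition collocation_mat :: "nat \<Rightarrow> (int \<Rightarrow> real) \<Rightarrow> (nat \<Rightarrow> real \<Rightarrow> real) \<Rightarrow> real mat" where
  "collocation_mat n x \<phi> = Matrix.mat n n (\<lambda>(i, j). \<phi> (j + 1) (x (int i + 1)))"

definition interpolant ::
    "nat \<Rightarrow> (int \<Rightarrow> real) \<Rightarrow> (nat \<Rightarrow> real \<Rightarrow> real) \<Rightarrow> (real \<Rightarrow> real) \<Rightarrow> real \<Rightarrow> real" where
  "interpolant n x \<phi> f =
    spline n x \<phi> (THE c. c \<in> carrier_vec n \<and>
      collocation_mat n x \<phi> *\<^sub>v c = Matrix.vec n (\<lambda>i. f (x (int i + 1))))"

definition cardinal_spline ::
    "nat \<Rightarrow> (int \<Rightarrow> real) \<Rightarrow> (nat \<Rightarrow> real \<Rightarrow> real) \<Rightarrow> nat \<Rightarrow> real \<Rightarrow> real" where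
  "cardinal_spline n x \<phi> l =
    spline n x \<phi> (Matrix.col (the (mat_inverse (collocation_mat n x \<phi>))) (l - 1))"

definition lebesgue_function ::
    "nat \<Rightarrow> (int \<Rightarrow> real) \<Rightarrow> (nat \<Rightarrow> real \<Rightarrow> real) \<Rightarrow> real \<Rightarrow> real" where
  "lebesgue_function n x \<phi> t = (\<Sum>l = 1..n. \<bar>cardinal_spline n x \<phi> l t\<bar>)"

definition sup_norm :: "real \<Rightarrow> real \<Rightarrow> (real \<Rightarrow> real) \<Rightarrow> real" where
  "sup_norm a b g = (SUP t\<in>{a..b}. \<bar>g t\<bar>)"

definition best_approximation ::
    "real \<Rightarrow> real \<Rightarrow> (real \<Rightarrow> real) set \<Rightarrow> (real \<Rightarrow> real) \<Rightarrow> (real \<Rightarrow> real) \<Rightarrow> bool" where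
  "best_approximation a b V f g \<longleftrightarrow>
    is_arg_min (\<lambda>h. sup_norm a b (\<lambda>t. f t - h t)) (\<lambda>h. h \<in> V) g"

end

theory Submission
  imports Defs
begin

text \<open>On \<open>[a, b]\<close> the interpolant of \<open>h\<close> is \<open>\<Sum>\<^sub>l h(x\<^sub>l) \<psi>\<^sub>l\<close>, and interpolation reproduces the spline
  space. Hence \<open>f - I f = (f - f\<^sup>*) - \<Sum>\<^sub>l (f - f\<^sup>*)(x\<^sub>l) \<psi>\<^sub>l\<close>, and the triangle inequality gives the
  bound.\<close>

text \<open>The cardinal splines are built from the computed \<open>mat_inverse\<close>, while the
  hypothesis on the collocation matrix is the abstract \<open>invertible_mat\<close>; this is the
  bridge between the two.\<close>

lemma mat_inverse_invertible:
  fixes A :: "'a :: field mat"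
  assumes "A \<in> carrier_mat n n" "invertible_mat A"
  obtains B where "mat_inverse A = Some B" "B \<in> carrier_mat n n" "A * B = 1\<^sub>m n" "B * A = 1\<^sub>m n"
proof -
  from assms obtain C where C: "inverts_mat A C" "inverts_mat C A"
    unfolding invertible_mat_def by blast
  have AC: "A * C = 1\<^sub>m n" and CA': "C * A = 1\<^sub>m (dim_row C)"
    using C assms(1) by (auto simp: inverts_mat_def)
  \<comment> \<open>\<open>invertible_mat\<close> does not state the shape of \<open>C\<close>, so
    both dimensions are read off by comparing column counts in \<open>AC\<close> and
    \<open>CA'\<close>.\<close>
  have "dim_col C = n" using arg_cong[OF AC, of dim_col] by simp
  moreover have "dim_row C = n" using arg_cong[OF CA', of dim_col] assms(1) by simp
  ultimately have Cc: "C \<in> carrier_mat n n" by auto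
  hence CA: "C * A = 1\<^sub>m n" using CA' by simp
  have "A \<in> Units (ring_mat TYPE('a) n ())"
    using assms(1) AC CA Cc unfolding Units_def ring_mat_def by auto
  \<comment> \<open>The result \<open>None\<close> would mean that \<open>A\<close> is not a unit of
    the matrix ring.\<close>
  with mat_inverse(1)[OF assms(1), of "()"] obtain B where "mat_inverse A = Some B"
    by (cases "mat_inverse A") auto
  with mat_inverse(2)[OF assms(1) this] that show thesis by blast
qed

lemma collocation_mat_carrier: "collocation_mat n x \<phi> \<in> carrier_mat n n"
  by (simp add: collocation_mat_def)

lemma collocation_mat_mult_index:
  assumes "c \<in> carrier_vec n" "i < n" "x (int i + 1) \<in> {x 1..x (int n)}"
  shows "(collocation_mat n x \<phi> *\<^sub>v c) $ i = spline n x \<phi> c (x (int i + 1))"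
proof -
  have "(collocation_mat n x \<phi> *\<^sub>v c) $ i = (\<Sum>j = 0..<n. \<phi> (j + 1) (x (int i + 1)) * c $ j)"
    using assms by (simp add: collocation_mat_def scalar_prod_def)
  also have "\<dots> = (\<Sum>j = 1..n. c $ (j - 1) * \<phi> j (x (int i + 1)))"
    by (rule sum.reindex_bij_witness[of _ "\<lambda>j. j - 1" "\<lambda>j. j + 1"]) auto
  finally show ?thesis using assms by (simp add: spline_def)
qed

text \<open>Column \<open>l - 1\<close> of \<open>B\<close> holds the coefficients of the cardinal
  spline with index \<open>l\<close>, so exchanging the two sums suffices. It is used with
  \<open>y\<close> the samples of \<open>f\<close> for the interpolant, and with \<open>y\<close>
  the image of a coefficient vector under the collocation matrix for reproduction.\<close>

lemma spline_inverse_mult: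
  assumes B: "mat_inverse (collocation_mat n x \<phi>) = Some B" "B \<in> carrier_mat n n"
    and y: "y \<in> carrier_vec n" and t: "t \<in> {x 1..x (int n)}"
  shows "spline n x \<phi> (B *\<^sub>v y) t = (\<Sum>l = 1..n. y $ (l - 1) * cardinal_spline n x \<phi> l t)"
proof -
  have mv: "(B *\<^sub>v y) $ (j - 1) = (\<Sum>l = 1..n. B $$ (j - 1, l - 1) * y $ (l - 1))"
    if "j \<in> {1..n}" for j
  proof -
    have "(B *\<^sub>v y) $ (j - 1) = (\<Sum>l = 0..<n. B $$ (j - 1, l) * y $ l)"
      using that B y by (auto simp: scalar_prod_def)
    also have "\<dots> = (\<Sum>l = 1..n. B $$ (j - 1, l - 1) * y $ (l - 1))"
      by (rule sum.reindex_bij_witness[of _ "\<lambda>j. j - 1" "\<lambda>j. j + 1"]) auto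
    finally show ?thesis .
  qed
  have "spline n x \<phi> (B *\<^sub>v y) t =
      (\<Sum>j = 1..n. \<Sum>l = 1..n. y $ (l - 1) * (B $$ (j - 1, l - 1) * \<phi> j t))"
    using t mv by (simp add: spline_def sum_distrib_left sum_distrib_right mult_ac)
  also have "\<dots> = (\<Sum>l = 1..n. \<Sum>j = 1..n. y $ (l - 1) * (B $$ (j - 1, l - 1) * \<phi> j t))"
    by (rule sum.swap)
  also have "\<dots> = (\<Sum>l = 1..n. y $ (l - 1) * cardinal_spline n x \<phi> l t)"
  proof (rule sum.cong)
    fix l assume "l \<in> {1..n}"
    then show "(\<Sum>j = 1..n. y $ (l - 1) * (B $$ (j - 1, l - 1) * \<phi> j t)) =
        y $ (l - 1) * cardinal_spline n x \<phi> l t"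
      using t B by (auto simp: cardinal_spline_def spline_def sum_distrib_left intro!: sum.cong)
  qed simp
  finally show ?thesis .
qed

lemma interpolant_eq_sum_cardinal:
  assumes inv: "invertible_mat (collocation_mat n x \<phi>)" and t: "t \<in> {x 1..x (int n)}"
  shows "interpolant n x \<phi> f t = (\<Sum>l = 1..n. f (x (int l)) * cardinal_spline n x \<phi> l t)"
proof -
  let ?A = "collocation_mat n x \<phi>" and ?y = "Matrix.vec n (\<lambda>i. f (x (int i + 1)))"
  obtain B where B: "mat_inverse ?A = Some B" "B \<in> carrier_mat n n"
    "?A * B = 1\<^sub>m n" "B * ?A = 1\<^sub>m n"
    using mat_inverse_invertible[OF collocation_mat_carrier inv] .
  \<comment> \<open>Existence rests on \<open>?A * B\<close> being the identity, uniqueness on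
    \<open>B * ?A\<close> being the identity.\<close>
  have "(THE c. c \<in> carrier_vec n \<and> ?A *\<^sub>v c = ?y) = B *\<^sub>v ?y"
  proof (rule the_equality)
    have "?A *\<^sub>v (B *\<^sub>v ?y) = (?A * B) *\<^sub>v ?y"
      using assoc_mult_mat_vec[OF collocation_mat_carrier B(2), of ?y] by simp
    then show "B *\<^sub>v ?y \<in> carrier_vec n \<and> ?A *\<^sub>v (B *\<^sub>v ?y) = ?y"
      using B by simp
  next
    fix c assume c: "c \<in> carrier_vec n \<and> ?A *\<^sub>v c = ?y"
    then have "B *\<^sub>v ?y = (B * ?A) *\<^sub>v c"
      using assoc_mult_mat_vec[OF B(2) collocation_mat_carrier, of c] by simp
    then show "c = B *\<^sub>v ?y" using c B by simp
  qed
  then have "interpolant n x \<phi> f t = (\<Sum>l = 1..n. ?y $ (l - 1) * cardinal_spline n x \<phi> l t)"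
    unfolding interpolant_def using spline_inverse_mult[OF B(1,2) _ t, of ?y] by simp
  also have "\<dots> = (\<Sum>l = 1..n. f (x (int l)) * cardinal_spline n x \<phi> l t)"
    by (rule sum.cong) (auto simp: of_nat_diff)
  finally show ?thesis .
qed

text \<open>Interpolation reproduces splines: if \<open>g\<close> has coefficients \<open>c\<close>,
  then \<open>c = B *\<^sub>v (?A *\<^sub>v c)\<close>, and the entries of
  \<open>?A *\<^sub>v c\<close> are the values of \<open>g\<close> at the nodes.\<close>

lemma spline_space_eq_sum_cardinal:
  assumes inv: "invertible_mat (collocation_mat n x \<phi>)" and t: "t \<in> {x 1..x (int n)}"
    and g: "g \<in> spline_space n x \<phi>"
    and nodes: "\<And>l. l \<in> {1..n} \<Longrightarrow> x (int l) \<in> {x 1..x (int n)}"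
  shows "g t = (\<Sum>l = 1..n. g (x (int l)) * cardinal_spline n x \<phi> l t)"
proof -
  let ?A = "collocation_mat n x \<phi>"
  obtain B where B: "mat_inverse ?A = Some B" "B \<in> carrier_mat n n" "B * ?A = 1\<^sub>m n"
    using mat_inverse_invertible[OF collocation_mat_carrier inv] .
  obtain c where c: "c \<in> carrier_vec n" "g = spline n x \<phi> c"
    using g by (auto simp: spline_space_def)
  have "B *\<^sub>v (?A *\<^sub>v c) = c"
    using assoc_mult_mat_vec[OF B(2) collocation_mat_carrier c(1), of x \<phi>] B(3) c(1) by simp
  then have "g t = (\<Sum>l = 1..n. (?A *\<^sub>v c) $ (l - 1) * cardinal_spline n x \<phi> l t)"
    using spline_inverse_mult[OF B(1,2) _ t, of "?A *\<^sub>v c"] c collocation_mat_carrier[of n x \<phi>]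
    by simp
  also have "\<dots> = (\<Sum>l = 1..n. g (x (int l)) * cardinal_spline n x \<phi> l t)"
  proof (rule sum.cong)
    fix l assume l: "l \<in> {1..n}"
    \<comment> \<open>Subtraction on naturals truncates, so the shift between indices from 1 and
      from 0 is undone only because \<open>l\<close> is at least 1.\<close>
    then have "int (l - 1) + 1 = int l" "l - 1 < n" by auto
    then show "(?A *\<^sub>v c) $ (l - 1) * cardinal_spline n x \<phi> l t =
        g (x (int l)) * cardinal_spline n x \<phi> l t"
      using collocation_mat_mult_index[OF c(1), of "l - 1" x \<phi>] nodes[OF l] c(2) by simp
  qed simp
  finally show ?thesis .
qed

lemma continuous_on_spline:
  assumes "\<And>j. j \<in> {1..n} \<Longrightarrow> gb_spline \<alpha> n x j (\<phi> j)"
  shows "continuous_on {x 1..x (int n)} (spline n x \<phi> c)"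
proof -
  have "continuous_on UNIV (\<phi> j)" if "j \<in> {1..n}" for j
    using assms[OF that] unfolding gb_spline_def C2_real_def
    by (meson DERIV_isCont continuous_at_imp_continuous_on)
  then have "continuous_on {x 1..x (int n)} (\<lambda>t. \<Sum>j = 1..n. c $ (j - 1) * \<phi> j t)"
    by (intro continuous_intros) (auto intro: continuous_on_subset)
  \<comment> \<open>The spline agrees with the sum only on the interval, being
    \<open>undefined\<close> outside, so continuity is transferred on that set.\<close>
  then show ?thesis
    by (rule continuous_on_eq) (simp add: spline_def)
qed

text \<open>A real \<open>SUP\<close> is known to be an upper bound only for a set bounded above;
  here compactness of the continuous image provides this.\<close>

lemma abs_le_sup_norm:
  assumes "continuous_on {a..b} g" "t \<in> {a..b}"
  shows "\<bar>g t\<bar> \<le> sup_norm a b g"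
proof -
  have "compact ((\<lambda>t. \<bar>g t\<bar>) ` {a..b})"
    using assms(1) by (intro compact_continuous_image continuous_intros) auto
  then have "bdd_above ((\<lambda>t. \<bar>g t\<bar>) ` {a..b})"
    by (simp add: bounded_imp_bdd_above compact_imp_bounded)
  then show ?thesis
    unfolding sup_norm_def using assms(2) by (rule cSUP_upper[rotated])
qed

theorem theorem3:
  fixes n :: nat and x :: "int \<Rightarrow> real" and a b \<alpha> :: real
    and \<phi> :: "nat \<Rightarrow> real \<Rightarrow> real" and f fstar :: "real \<Rightarrow> real"
  assumes "n \<ge> 2"
    and "\<alpha> > 0"
    and "augmented_nodes n x" and "x 1 = a" and "x (int n) = b"
    and "\<And>j. j \<in> {1..n} \<Longrightarrow> gb_spline \<alpha> n x j (\<phi> j)"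
    and "invertible_mat (collocation_mat n x \<phi>)"
    and "continuous_on {a..b} f"
    and "best_approximation a b (spline_space n x \<phi>) f fstar"
  shows "\<forall>t\<in>{a..b}. \<bar>f t - interpolant n x \<phi> f t\<bar>
           \<le> (1 + lebesgue_function n x \<phi> t) * sup_norm a b (\<lambda>s. f s - fstar s)"
proof
  fix t assume t: "t \<in> {a..b}"
  let ?e = "\<lambda>s. f s - fstar s" and ?\<psi> = "cardinal_spline n x \<phi>"
  let ?N = "sup_norm a b ?e"
  have "mono_on {-1..int n + 2} x"
    using assms(3) unfolding augmented_nodes_def by (rule strict_mono_on_imp_mono_on)
  then have nodes: "x (int l) \<in> {x 1..x (int n)}" if "l \<in> {1..n}" for l
    using that by (auto intro: mono_onD)
  have fstar: "fstar \<in> spline_space n x \<phi>"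
    using assms(9) by (simp add: best_approximation_def is_arg_min_def)
  have "continuous_on {a..b} fstar"
    using fstar continuous_on_spline[OF assms(6)] assms(4,5) by (auto simp: spline_space_def)
  then have e_le: "\<bar>?e s\<bar> \<le> ?N" if "s \<in> {a..b}" for s
    using abs_le_sup_norm[of a b ?e s] assms(8) that by (simp add: continuous_on_diff)
  have t': "t \<in> {x 1..x (int n)}" using t assms(4,5) by simp
  \<comment> \<open>Add and subtract \<open>fstar t\<close>, then expand the added copy by
    reproduction, so that both sums run over the same cardinal splines.\<close>
  have "f t - interpolant n x \<phi> f t =
      ?e t + (\<Sum>l = 1..n. fstar (x (int l)) * ?\<psi> l t) - (\<Sum>l = 1..n. f (x (int l)) * ?\<psi> l t)"
    using interpolant_eq_sum_cardinal[OF assms(7) t', of f]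
      spline_space_eq_sum_cardinal[OF assms(7) t' fstar nodes] by simp
  also have "\<dots> = ?e t - (\<Sum>l = 1..n. ?e (x (int l)) * ?\<psi> l t)"
    by (simp add: left_diff_distrib sum_subtractf)
  finally have "\<bar>f t - interpolant n x \<phi> f t\<bar> = \<bar>?e t - (\<Sum>l = 1..n. ?e (x (int l)) * ?\<psi> l t)\<bar>"
    by simp
  also have "\<dots> \<le> \<bar>?e t\<bar> + \<bar>\<Sum>l = 1..n. ?e (x (int l)) * ?\<psi> l t\<bar>"
    by (rule abs_triangle_ineq4)
  \<comment> \<open>All nodes lie in \<open>{a..b}\<close>, so one bound \<open>?N\<close> covers
    the error at \<open>t\<close> and at every node; factoring it out leaves the Lebesgue
    function.\<close>
  also have "\<dots> \<le> ?N + (\<Sum>l = 1..n. ?N * \<bar>?\<psi> l t\<bar>)"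
  proof (rule add_mono[OF e_le[OF t]])
    show "\<bar>\<Sum>l = 1..n. ?e (x (int l)) * ?\<psi> l t\<bar> \<le> (\<Sum>l = 1..n. ?N * \<bar>?\<psi> l t\<bar>)"
    proof (rule order_trans[OF sum_abs sum_mono])
      fix l assume "l \<in> {1..n}"
      then have "\<bar>?e (x (int l))\<bar> \<le> ?N" using e_le nodes assms(4,5) by blast
      then show "\<bar>?e (x (int l)) * ?\<psi> l t\<bar> \<le> ?N * \<bar>?\<psi> l t\<bar>"
        unfolding abs_mult by (rule mult_right_mono) simp
    qed
  qed
  also have "\<dots> = (1 + lebesgue_function n x \<phi> t) * ?N"
    by (simp add: lebesgue_function_def sum_distrib_left algebra_simps)
  finally show "\<bar>f t - interpolant n x \<phi> f t\<bar> \<le> (1 + lebesgue_function n x \<phi> t) * ?N" .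
qed

end
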